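(* Let $n\ge 2$ and let $L \in \mathcal W^*_n$. Then any $n$ linearly independent vectors from $S(L)$ form a basis for $L$ (over $\mathbb Z$).
   Context: A lattice $L$ means a lattice of rank $n\ge 2$ in $\mathbb R^n$. $\|\cdot\|$ is the Euclidean norm, $|L| = \min\{\|x\| : x\in L\setminus\{0\}\}$, and $S(L)=\{x\in L:\|x\|=|L|\}$ is the set of minimal vectors. $L$ is well-rounded (WR) if $\mathrm{span}_{\mathbb R}S(L)=\mathrm{span}_{\mathbb R}L$. For an ordered basis $\{b_1,\dots,b_n\}$ of $L$, let $\theta_i\in(0,\pi/2]$ ($1\le i\le n-1$) be the angle between $b_{i+1}$ and the subspace $\mathrm{span}_{\mathbb R}\{b_1,\dots,b_i\}$. The ordered basis is weakly nearly orthogonal if $\theta_i\ge\pi/3$ for all $1\le i\le n-1$; a basis is nearly orthogonal if every ordering of it is weakly nearly orthogonal. Two lattices $L_1,L_2$ are similar if $L_2=\alpha U L_1$ with $\alpha>0$ and $U$ real orthogonal. $\mathcal W^*_n$ is the set of similarity classes of WR lattices in $\mathbb R^n$ that have a nearly orthogonal basis; each class is represented by a lattice with minimal norm $1$. *)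

theory Defs
  imports "HOL-Analysis.Analysis"
begin

definition lattice_basis :: "(real^'n) set \<Rightarrow> (real^'n) set \<Rightarrow> bool" where
  "lattice_basis L B \<longleftrightarrow>
     independent B \<and> card B = CARD('n) \<and>
     L = {x. \<exists>c :: real^'n \<Rightarrow> int. x = (\<Sum>b\<in>B. of_int (c b) *\<^sub>R b)}"

definition full_rank_lattice :: "(real^'n) set \<Rightarrow> bool" where
  "full_rank_lattice L \<longleftrightarrow> (\<exists>B. lattice_basis L B)"

text \<open>The infimum is a minimum whenever \<open>L\<close> is a lattice.\<close>

definition min_norm :: "(real^'n) set \<Rightarrow> real" where
  "min_norm L = Inf (norm ` (L - {0}))"

definition min_vectors :: "(real^'n) set \<Rightarrow> (real^'n) set" where
  "min_vectors L = {x \<in> L. norm x = min_norm L}"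

definition well_rounded :: "(real^'n) set \<Rightarrow> bool" where
  "well_rounded L \<longleftrightarrow> span (min_vectors L) = span L"

definition vector_angle :: "real^'n \<Rightarrow> real^'n \<Rightarrow> real" where
  "vector_angle x y = arccos (x \<bullet> y / (norm x * norm y))"

text \<open>The angle between a nonzero vector and a nonzero subspace is the least angle to a nonzero
  vector of the subspace. It lies in \<open>[0, pi/2]\<close> because the subspace contains \<open>- w\<close> with \<open>w\<close>,
  and it is positive for a vector outside the subspace.\<close>

definition subspace_angle :: "real^'n \<Rightarrow> (real^'n) set \<Rightarrow> real" where
  "subspace_angle x W = Inf (vector_angle x ` (W - {0}))"

text \<open>Lists are indexed from 0, so \<open>bs ! i\<close> is $b_{i+1}$ and \<open>take i bs\<close> is $b_1, \dots, b_i$.\<close>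

definition weakly_nearly_orthogonal :: "(real^'n) list \<Rightarrow> bool" where
  "weakly_nearly_orthogonal bs \<longleftrightarrow>
     (\<forall>i\<in>{1..<length bs}. subspace_angle (bs ! i) (span (set (take i bs))) \<ge> pi / 3)"

definition nearly_orthogonal :: "(real^'n) set \<Rightarrow> bool" where
  "nearly_orthogonal B \<longleftrightarrow>
     (\<forall>bs. distinct bs \<and> set bs = B \<longrightarrow> weakly_nearly_orthogonal bs)"

definition similar_lattices :: "(real^'n) set \<Rightarrow> (real^'n) set \<Rightarrow> bool" where
  "similar_lattices L1 L2 \<longleftrightarrow>
     (\<exists>(\<alpha>::real) (U::real^'n^'n). \<alpha> > 0 \<and> orthogonal_matrix U \<and>
        L2 = (\<lambda>x. \<alpha> *\<^sub>R (U *v x)) ` L1)"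

definition similarity_class :: "(real^'n) set \<Rightarrow> (real^'n) set set" where
  "similarity_class L = {L'. similar_lattices L L'}"

definition WR_nearly_orthogonal_classes :: "(real^'n) set set set" where
  "WR_nearly_orthogonal_classes =
     similarity_class ` {L. full_rank_lattice L \<and> well_rounded L \<and>
                            (\<exists>B. lattice_basis L B \<and> nearly_orthogonal B)}"

end

theory Submission
  imports Defs
begin

text \<open>If \<open>b\<close> occurs in the expansion of a minimal vector \<open>x\<close> with respect to a nearly orthogonal
  basis \<open>B\<close>, then \<open>x\<close> is \<open>\<plusminus>b\<close> or \<open>\<plusminus>(b - u)\<close>, where \<open>b\<close> and \<open>u\<close> are minimal, \<open>u\<close> lies in the
  span of \<open>B - {b}\<close> and the angle between \<open>b\<close> and \<open>u\<close> is exactly \<open>pi/3\<close>. A subspace whose angle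
  to \<open>b\<close> is at least \<open>pi/3\<close> contains only one such \<open>u\<close>, and so \<open>u\<close> must be \<open>\<plusminus>\<close> another element of \<open>B\<close>. Thus
  the minimal vectors are \<open>\<plusminus>b\<close> for \<open>b\<close> in \<open>B\<close> and \<open>\<plusminus>(b \<plusminus> b')\<close> for the pairs of a partial
  matching of \<open>B\<close>, with one sign for each pair. A spanning set of minimal vectors contains two
  independent ones from each matched pair, and these generate the pair over the integers.\<close>

section \<open>Integer combinations of a set of vectors\<close>

definition int_span :: "'a::real_vector set \<Rightarrow> 'a set" where
  "int_span A = {x. \<exists>c :: 'a \<Rightarrow> int. x = (\<Sum>a\<in>A. of_int (c a) *\<^sub>R a)}"

lemma int_span_add:
  assumes "x \<in> int_span A" "y \<in> int_span A"
  shows "x + y \<in> int_span A"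
proof -
  obtain c d :: "'a \<Rightarrow> int" where "x = (\<Sum>a\<in>A. of_int (c a) *\<^sub>R a)"
    "y = (\<Sum>a\<in>A. of_int (d a) *\<^sub>R a)"
    using assms unfolding int_span_def by auto
  then have "x + y = (\<Sum>a\<in>A. of_int (c a + d a) *\<^sub>R a)"
    by (simp add: sum.distrib scaleR_left_distrib)
  then show ?thesis unfolding int_span_def by (auto intro!: exI[of _ "\<lambda>a. c a + d a"])
qed

lemma int_span_scale:
  assumes "x \<in> int_span A"
  shows "of_int k *\<^sub>R x \<in> int_span A"
proof -
  obtain c :: "'a \<Rightarrow> int" where "x = (\<Sum>a\<in>A. of_int (c a) *\<^sub>R a)"
    using assms unfolding int_span_def by auto
  then have "of_int k *\<^sub>R x = (\<Sum>a\<in>A. of_int (k * c a) *\<^sub>R a)"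
    by (simp add: scaleR_sum_right)
  then show ?thesis unfolding int_span_def by (auto intro!: exI[of _ "\<lambda>a. k * c a"])
qed

lemma int_span_zero: "0 \<in> int_span A"
  unfolding int_span_def by (auto intro!: exI[of _ "\<lambda>_. 0"])

lemma int_span_minus: "x \<in> int_span A \<Longrightarrow> - x \<in> int_span A"
  using int_span_scale[of x A "-1"] by simp

lemma int_span_sum: "(\<And>i. i \<in> I \<Longrightarrow> f i \<in> int_span A) \<Longrightarrow> sum f I \<in> int_span A"
  by (induction I rule: infinite_finite_induct) (auto intro: int_span_add int_span_zero)

lemma int_span_base:
  assumes "finite A" "a \<in> A"
  shows "a \<in> int_span A"
proof -
  have "a = (\<Sum>x\<in>A. of_int (if x = a then 1 else 0) *\<^sub>R x)"
    using assms by (simp add: if_distrib[of "\<lambda>k. of_int k *\<^sub>R _"] cong: if_cong)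
  then show ?thesis unfolding int_span_def
    by (intro CollectI exI[of _ "\<lambda>x. if x = a then 1 else 0"])
qed

lemma int_span_subset: "A \<subseteq> int_span S \<Longrightarrow> int_span A \<subseteq> int_span S"
  by (subst int_span_def) (auto intro!: int_span_sum int_span_scale)

lemma int_span_image:
  assumes "linear g" "inj g"
  shows "int_span (g ` A) = g ` int_span A"
proof -
  have inj: "inj_on g A" using assms(2) by (rule inj_on_subset) auto
  have *: "(\<Sum>a\<in>g ` A. of_int (c a) *\<^sub>R a) = g (\<Sum>a\<in>A. of_int (c (g a)) *\<^sub>R a)" for c :: "'b \<Rightarrow> int"
    using assms(1) by (simp add: sum.reindex[OF inj] linear_sum linear_cmul)
  have "g (\<Sum>a\<in>A. of_int (c a) *\<^sub>R a) \<in> int_span (g ` A)" for c :: "'a \<Rightarrow> int"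
    using *[of "\<lambda>y. c (inv g y)"] assms(2) unfolding int_span_def
    by (auto intro!: exI[of _ "\<lambda>y. c (inv g y)"])
  then show ?thesis
    using * unfolding int_span_def by (auto 0 3)
qed

lemma lattice_basis_iff:
  "lattice_basis L (B :: (real^'n) set) \<longleftrightarrow> independent B \<and> card B = CARD('n) \<and> L = int_span B"
  unfolding lattice_basis_def int_span_def by simp

section \<open>Minimal vectors relative to a basis with angles of at least 60 degrees\<close>

locale short_angle_basis =
  fixes B :: "'a::real_inner set" and m :: real
  assumes finite_B: "finite B" and indep_B: "independent B" and span_B: "span B = UNIV"
    and angle: "\<And>b w. b \<in> B \<Longrightarrow> w \<in> span (B - {b}) \<Longrightarrow> \<bar>b \<bullet> w\<bar> \<le> norm b * norm w / 2"
    and m_pos: "m > 0"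
    and m_le: "\<And>x. x \<in> int_span B \<Longrightarrow> x \<noteq> 0 \<Longrightarrow> m \<le> norm x"
begin

definition coord :: "'a \<Rightarrow> 'a \<Rightarrow> real" where
  "coord b x = representation B x b"

lemma linear_coord: "linear (coord b)"
  unfolding coord_def
  by (rule linearI) (simp_all add: representation_add representation_scale indep_B span_B)

lemma coord_basis: "b \<in> B \<Longrightarrow> a \<in> B \<Longrightarrow> coord b a = (if a = b then 1 else 0)"
  by (simp add: coord_def representation_basis[OF indep_B])

lemma coord_others:
  assumes "b \<in> B" "w \<in> span (B - {b})"
  shows "coord b w = 0"
  by (rule linear_eq_0_on_span[OF linear_coord _ assms(2)]) (use assms(1) coord_basis in auto)

lemma int_span_decompose:
  assumes "x \<in> int_span B" "b \<in> B"
  obtains k :: int and w where "x = of_int k *\<^sub>R b + w" "w \<in> int_span B" "w \<in> span (B - {b})"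
    "coord b x = of_int k"
proof -
  obtain c :: "'a \<Rightarrow> int" where x: "x = (\<Sum>a\<in>B. of_int (c a) *\<^sub>R a)"
    using assms unfolding int_span_def by auto
  define w where "w = (\<Sum>a\<in>B - {b}. of_int (c a) *\<^sub>R a)"
  have xw: "x = of_int (c b) *\<^sub>R b + w"
    unfolding x w_def using finite_B assms(2) by (simp add: sum.remove)
  have w1: "w \<in> int_span B" unfolding w_def
    by (intro int_span_sum int_span_scale int_span_base finite_B) auto
  have w2: "w \<in> span (B - {b})" unfolding w_def
    by (intro span_sum span_scale span_base) auto
  have "coord b x = of_int (c b)"
    unfolding xw using assms(2) w2
    by (simp add: linear_add[OF linear_coord] linear_cmul[OF linear_coord] coord_basis coord_others)
  then show ?thesis using that xw w1 w2 by blast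
qed

text \<open>Split \<open>x\<close> as \<open>k b + w\<close> and put \<open>s = |k| norm b\<close>,
  \<open>t = norm w\<close>. The angle bound gives \<open>s^2 - s t + t^2 \<le> m^2\<close>, which
  forces \<open>|k| = 1\<close>. If \<open>w\<close> is nonzero, then \<open>s\<close> and
  \<open>t\<close> are at least \<open>m\<close>, so equality holds throughout and \<open>b\<close>,
  \<open>w\<close> and \<open>x\<close> are, up to sign, the sides of an equilateral
  triangle.\<close>

lemma minimal_vector_cases:
  assumes x: "x \<in> int_span B" "norm x = m" and b: "b \<in> B" "coord b x \<noteq> 0"
  obtains e where "e = 1 \<or> e = -1" "x = e *\<^sub>R b"
  | e u where "e = 1 \<or> e = -1" "x = e *\<^sub>R (b - u)" "u \<in> int_span B" "u \<in> span (B - {b})"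
      "norm b = m" "norm u = m" "b \<bullet> u = m\<^sup>2 / 2"
proof -
  obtain k w where kw: "x = of_int k *\<^sub>R b + w" "w \<in> int_span B" "w \<in> span (B - {b})"
    "coord b x = of_int k"
    using int_span_decompose[OF x(1) b(1)] .
  have k0: "k \<noteq> 0" using kw(4) b(2) by auto
  have bm: "m \<le> norm b"
    using m_le[of b] int_span_base[OF finite_B b(1)] b(1) indep_B dependent_zero by blast
  define s where "s = \<bar>real_of_int k\<bar> * norm b"
  have sq: "m\<^sup>2 = s\<^sup>2 + 2 * (of_int k * (b \<bullet> w)) + (norm w)\<^sup>2"
    unfolding x(2)[symmetric] kw(1) s_def
    by (simp add: power_mult_distrib power2_norm_eq_inner inner_add_left inner_add_right
        inner_commute algebra_simps power2_eq_square[of "real_of_int k"])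
  have "\<bar>of_int k * (b \<bullet> w)\<bar> \<le> s * norm w / 2"
    using mult_left_mono[OF angle[OF b(1) kw(3)], of "\<bar>of_int k\<bar>"]
    by (simp add: s_def abs_mult)
  then have low: "m\<^sup>2 \<ge> s\<^sup>2 - s * norm w + (norm w)\<^sup>2" using sq by (simp add: abs_le_iff)
  \<comment> \<open>Complete the square:
    \<open>s^2 - s t + t^2 = (t - s/2)^2 + 3/4 s^2\<close>.\<close>
  have s34: "3 / 4 * s\<^sup>2 \<le> m\<^sup>2"
    using low zero_le_power2[of "norm w - s / 2"] by (simp add: power2_eq_square algebra_simps)
  have k2: "\<bar>k\<bar> < 2"
  proof (rule ccontr)
    assume "\<not> \<bar>k\<bar> < 2"
    then have "2 \<le> \<bar>real_of_int k\<bar>" by linarith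
    from mult_mono[OF this bm] have "2 * m \<le> s" using m_pos by (simp add: s_def)
    from power_mono[OF this, of 2] m_pos have "4 * m\<^sup>2 \<le> s\<^sup>2" by (simp add: power_mult_distrib)
    with s34 have "m\<^sup>2 \<le> 0" by linarith
    with m_pos show False by simp
  qed
  define e where "e = real_of_int k"
  have e: "e = 1 \<or> e = -1" using k2 k0 unfolding e_def by (cases "k = 1"; cases "k = -1") auto
  have sb: "s = norm b" using e unfolding s_def e_def by auto
  show thesis
  proof (cases "w = 0")
    case True
    then show thesis using that(1)[OF e] kw(1) by (simp add: e_def)
  next
    case False
    define t where "t = norm w"
    have tm: "m \<le> t" unfolding t_def using m_le[OF kw(2) False] .
    have sm: "m \<le> s" using bm sb by simp
    \<comment> \<open>\<open>s\<^sup>2 - s t + t\<^sup>2 = (s - m) (t - m) + (s - t)\<^sup>2 + m (s + t - m)\<close>, where all three terms are nonnegative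
       and the last is at least \<open>m\<^sup>2\<close>.\<close>
    have "(s - m) * (t - m) + (s - t)\<^sup>2 + m * ((s - m) + (t - m)) \<le> 0"
      using low unfolding t_def[symmetric] by (simp add: power2_eq_square algebra_simps)
    moreover have "0 \<le> (s - m) * (t - m)" using sm tm by simp
    moreover have "0 \<le> m * ((s - m) + (t - m))" using sm tm m_pos by simp
    ultimately have "m * ((s - m) + (t - m)) = 0" using zero_le_power2[of "s - t"] by linarith
    then have st: "s = m" "t = m" using sm tm m_pos by auto
    define u where "u = - (e *\<^sub>R w)"
    have ee: "e * e = 1" using e by auto
    have 1: "x = e *\<^sub>R (b - u)"
      unfolding u_def kw(1) e_def[symmetric] by (simp add: scaleR_right_distrib ee)
    have 2: "u \<in> int_span B" unfolding u_def e_def by (intro int_span_minus int_span_scale kw)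
    have 3: "u \<in> span (B - {b})" unfolding u_def by (intro span_neg span_scale kw)
    have 4: "norm u = m" using e st(2) unfolding u_def t_def by auto
    have 5: "b \<bullet> u = m\<^sup>2 / 2"
      using sq st unfolding u_def t_def e_def[symmetric] by simp
    show thesis using that(2)[OF e 1 2 3 _ 4 5] st(1) sb by simp
  qed
qed

text \<open>The angle bound for \<open>u + v\<close> gives \<open>norm (u + v) \<ge> 2 m\<close>,
  and then the parallelogram law leaves no room for \<open>u - v\<close>.\<close>

lemma sixty_degree_neighbour_unique:
  assumes b: "b \<in> B" "norm b = m"
    and u: "u \<in> span (B - {b})" "norm u = m" "b \<bullet> u = m\<^sup>2 / 2"
    and v: "v \<in> span (B - {b})" "norm v = m" "b \<bullet> v = m\<^sup>2 / 2"
  shows "u = v"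
proof -
  have "b \<bullet> (u + v) = m\<^sup>2" using u v by (simp add: inner_add_right)
  then have "m * m \<le> m * (norm (u + v) / 2)"
    using angle[OF b(1) span_add[OF u(1) v(1)]] b(2) by (simp add: power2_eq_square)
  then have "2 * m \<le> norm (u + v)" using m_pos by simp
  from power_mono[OF this, of 2] m_pos have "4 * m\<^sup>2 \<le> (norm (u + v))\<^sup>2"
    by (simp add: power_mult_distrib)
  moreover have "(norm (u + v))\<^sup>2 + (norm (u - v))\<^sup>2 = 2 * (norm u)\<^sup>2 + 2 * (norm v)\<^sup>2"
    by (simp add: power2_norm_eq_inner inner_simps inner_commute)
  ultimately have "(norm (u - v))\<^sup>2 \<le> 0" unfolding u(2) v(2) by linarith
  then show ?thesis by simp
qed

text \<open>If neither vector is \<open>b\<close> up to sign, both have the form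
  \<open>b - u\<close> up to sign, with the same \<open>u\<close> by uniqueness.\<close>

lemma minimal_vectors_sharing_coord:
  assumes "x \<in> int_span B" "norm x = m" "y \<in> int_span B" "norm y = m"
    and b: "b \<in> B" "coord b x \<noteq> 0" "coord b y \<noteq> 0"
  shows "x = b \<or> x = -b \<or> y = b \<or> y = -b \<or> x = y \<or> x = -y"
  using minimal_vector_cases[OF assms(1,2) b(1,2)]
proof cases
  case (2 e u)
  note x = 2
  show ?thesis using minimal_vector_cases[OF assms(3,4) b(1,3)]
  proof cases
    case (2 d v)
    have "u = v" by (rule sixty_degree_neighbour_unique[OF b(1)]) (use x 2 in auto)
    then show ?thesis using x(1,2) 2(1,2) by auto
  qed auto
qed auto

text \<open>The neighbour \<open>u\<close> is itself minimal and shares some coordinate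
  \<open>b'\<close> with \<open>x\<close>. Since \<open>coord b\<close> is nonzero at
  \<open>x\<close> but zero at \<open>u\<close> and \<open>b'\<close>, the only remaining
  possibility is that \<open>u\<close> is \<open>b'\<close> up to sign.\<close>

lemma minimal_vector_form:
  assumes x: "x \<in> int_span B" "norm x = m" and b: "b \<in> B" "coord b x \<noteq> 0"
  obtains e where "e = 1 \<or> e = -1" "x = e *\<^sub>R b"
  | e d b' where "e = 1 \<or> e = -1" "d = 1 \<or> d = -1" "b' \<in> B" "b' \<noteq> b" "x = e *\<^sub>R (b - d *\<^sub>R b')"
  using minimal_vector_cases[OF x b]
proof cases
  case (2 e u)
  have "u \<noteq> 0" using 2 m_pos by auto
  have "\<exists>b'\<in>B. coord b' u \<noteq> 0"
  proof (rule ccontr)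
    assume "\<not> ?thesis"
    then have "u = 0" using sum_representation_eq[OF indep_B, of u B] span_B finite_B
      by (auto simp: coord_def)
    with \<open>u \<noteq> 0\<close> show False ..
  qed
  then obtain b' where b': "b' \<in> B" "coord b' u \<noteq> 0" by blast
  have ne: "b' \<noteq> b" using coord_others[OF b(1) 2(4)] b' by auto
  have "coord b' x \<noteq> 0" unfolding 2(2)
    using b' b(1) ne 2(1)
    by (auto simp: linear_cmul[OF linear_coord] linear_diff[OF linear_coord] coord_basis)
  from minimal_vectors_sharing_coord[OF x 2(3) 2(6) b'(1) this b'(2)]
  have "x = b' \<or> x = - b' \<or> u = b' \<or> u = - b' \<or> x = u \<or> x = - u" .
  moreover have "coord b x = e"
    unfolding 2(2) using b(1) 2(4)
    by (simp add: linear_cmul[OF linear_coord] linear_diff[OF linear_coord] coord_basis coord_others)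
  moreover have "coord b b' = 0" "coord b u = 0"
    using b(1) b'(1) ne 2(4) by (auto simp: coord_basis coord_others)
  ultimately have "u = b' \<or> u = - b'"
    using 2(1) linear_neg[OF linear_coord, of b] by auto
  then show thesis
  proof
    assume "u = b'" then show thesis using that(2)[of e 1 b'] 2 b' ne by auto
  next
    assume "u = - b'" then show thesis using that(2)[of e "-1" b'] 2 b' ne by auto
  qed
qed (use that in auto)

text \<open>Some \<open>v\<close> in \<open>V\<close> involves \<open>b\<close>. Unless it is
  \<open>b\<close> up to sign, it pairs \<open>b\<close> with some \<open>b'\<close>; a second
  vector of \<open>V\<close> involving this pair must be \<open>b\<close> or \<open>b'\<close> up to
  sign, and together with \<open>v\<close> it yields \<open>b\<close>.\<close>

lemma basis_subset_int_span:
  assumes V: "finite V" "span V = UNIV" "V \<subseteq> int_span B" "\<And>v. v \<in> V \<Longrightarrow> norm v = m"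
  shows "B \<subseteq> int_span V"
proof
  fix b assume b: "b \<in> B"
  have detect: "\<exists>v\<in>V. f v \<noteq> 0" if "linear f" "f b \<noteq> 0" for f :: "'a \<Rightarrow> real"
    using linear_eq_0_on_span[OF that(1), of V b] that(2) V(2) by auto
  obtain v where v: "v \<in> V" "coord b v \<noteq> 0"
    using detect[OF linear_coord, of b] b by (auto simp: coord_basis)
  have vL: "v \<in> int_span B" "norm v = m" "v \<in> int_span V" using v V int_span_base by auto
  show "b \<in> int_span V" using minimal_vector_form[OF vL(1,2) b v(2)]
  proof cases
    case (1 e)
    then show ?thesis using vL(3) int_span_minus[OF vL(3)] by auto
  next
    case (2 e d b')
    \<comment> \<open>This functional vanishes on \<open>v\<close>, so it detects a vector of \<open>V\<close> that involves \<open>b\<close> or \<open>b'\<close> and is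
       not \<open>\<plusminus>v\<close>.\<close>
    define f where "f = (\<lambda>x. coord b x + d * coord b' x)"
    have f: "linear f" unfolding f_def
      using linear_compose_add[OF linear_coord linear_compose_scale_right[OF linear_coord], of b d b']
      by simp
    have fb: "f b = 1" using b 2 by (simp add: f_def coord_basis)
    have fv: "f v = 0" unfolding 2(5) linear_cmul[OF f] linear_diff[OF f] fb
      using b 2 by (auto simp: f_def coord_basis linear_cmul[OF linear_coord])
    obtain y where y: "y \<in> V" "f y \<noteq> 0" using detect[OF f] fb by auto
    have yL: "y \<in> int_span B" "norm y = m" "y \<in> int_span V" using y V int_span_base by auto
    have ny: "v \<noteq> y" "v \<noteq> - y" using fv y(2) linear_neg[OF f, of y] by auto
    have cv: "coord b v = e" "coord b' v = - e * d"
      using b 2 by (auto simp: coord_basis linear_cmul[OF linear_coord] linear_diff[OF linear_coord])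
    have v0: "v \<noteq> b" "v \<noteq> - b" "v \<noteq> b'" "v \<noteq> - b'"
      using cv b 2(1-4) linear_neg[OF linear_coord] by (auto simp: coord_basis)
    have "y = b \<or> y = -b \<or> y = b' \<or> y = -b'"
    proof (cases "coord b y = 0")
      case True
      then have "coord b' y \<noteq> 0" using y(2) by (auto simp: f_def)
      moreover have "coord b' v \<noteq> 0" using cv 2 by auto
      ultimately show ?thesis
        using minimal_vectors_sharing_coord[OF vL(1,2) yL(1,2) 2(3)] v0 ny by blast
    next
      case False
      then show ?thesis
        using minimal_vectors_sharing_coord[OF vL(1,2) yL(1,2) b v(2)] v0 ny by blast
    qed
    then have "b \<in> int_span V \<or> b' \<in> int_span V"
      using yL(3) int_span_minus[OF yL(3)] by auto
    moreover have "b = e *\<^sub>R v + d *\<^sub>R b'" unfolding 2(5) using 2(1) by auto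
    moreover have "e *\<^sub>R v \<in> int_span V" using 2(1) vL(3) int_span_minus[OF vL(3)] by auto
    moreover have "d *\<^sub>R b' \<in> int_span V" if "b' \<in> int_span V"
      using 2(2) that int_span_minus[OF that] by auto
    ultimately show ?thesis using int_span_add by metis
  qed
qed

end

section \<open>From angles to inner products\<close>

lemma abs_inner_le_if_subspace_angle_ge:
  fixes x w :: "real^'n"
  assumes "subspace_angle x W \<ge> pi / 3" "subspace W" "w \<in> W"
  shows "\<bar>x \<bullet> w\<bar> \<le> norm x * norm w / 2"
proof -
  have cos_bound: "\<bar>x \<bullet> y / (norm x * norm y)\<bar> \<le> 1" for y :: "real^'n"
    using Cauchy_Schwarz_ineq2[of x y]
    by (cases "norm x * norm y = 0") (auto simp: abs_mult divide_le_eq_1)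
  have cos_bounds: "-1 \<le> x \<bullet> y / (norm x * norm y)" "x \<bullet> y / (norm x * norm y) \<le> 1" for y
    using cos_bound[of y] by linarith+
  have half: "x \<bullet> y \<le> norm x * norm y / 2" if "y \<in> W" "x \<noteq> 0" "y \<noteq> 0" for y
  proof -
    \<comment> \<open>An infimum of reals lies below every element only if the set is bounded below;
      here 0 is a bound.\<close>
    have "bdd_below (vector_angle x ` (W - {0}))"
      unfolding vector_angle_def
      by (intro bdd_belowI2[of _ 0] arccos_lbound cos_bounds)
    then have "subspace_angle x W \<le> vector_angle x y"
      unfolding subspace_angle_def using that by (intro cInf_lower) auto
    then have "pi / 3 \<le> arccos (x \<bullet> y / (norm x * norm y))"
      using assms(1) by (simp add: vector_angle_def)
    moreover have "arccos (x \<bullet> y / (norm x * norm y)) \<le> pi"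
      by (intro arccos_ubound cos_bounds)
    ultimately have "cos (arccos (x \<bullet> y / (norm x * norm y))) \<le> cos (pi / 3)"
      by (intro cos_monotone_0_pi_le) auto
    then have "x \<bullet> y / (norm x * norm y) \<le> 1 / 2"
      using cos_arccos_abs[OF cos_bound[of y]] by (simp add: cos_60)
    then show ?thesis using that by (simp add: field_simps)
  qed
  show ?thesis
  proof (cases "x = 0 \<or> w = 0")
    case False
    \<comment> \<open>Applying the bound to \<open>- w\<close>, also in \<open>W\<close>, gives the
      absolute value.\<close>
    then show ?thesis using half[of w] half[of "- w"] assms(2,3) subspace_neg[of W w]
      by (auto simp: abs_le_iff)
  qed auto
qed

text \<open>List \<open>b\<close> last, so that its angle is taken with the span of all other basis
  vectors.\<close>

lemma nearly_orthogonal_abs_inner_le: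
  fixes B :: "(real^'n) set"
  assumes "nearly_orthogonal B" "finite B" "b \<in> B" "w \<in> span (B - {b})"
  shows "\<bar>b \<bullet> w\<bar> \<le> norm b * norm w / 2"
\<comment> \<open>Angles start at index 1, so a one-element list carries no condition; but then
  \<open>w = 0\<close>.\<close>
proof (cases "B = {b}")
  case True
  then show ?thesis using assms(4) by auto
next
  case False
  obtain cs where cs: "set cs = B - {b}" "distinct cs"
    using finite_distinct_list[of "B - {b}"] assms(2) by auto
  have "set (cs @ [b]) = B" "distinct (cs @ [b])"
    using assms(3) cs by auto
  then have "weakly_nearly_orthogonal (cs @ [b])"
    using assms(1) unfolding nearly_orthogonal_def by blast
  moreover have "length cs \<in> {1..<length (cs @ [b])}"
    using cs(1) False assms(3) by (cases cs) auto
  ultimately have "subspace_angle ((cs @ [b]) ! length cs)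
      (span (set (take (length cs) (cs @ [b])))) \<ge> pi / 3"
    unfolding weakly_nearly_orthogonal_def by blast
  then have "subspace_angle b (span (set cs)) \<ge> pi / 3" by simp
  then show ?thesis
    using abs_inner_le_if_subspace_angle_ge[OF _ subspace_span] assms(4) cs(1) by metis
qed

section \<open>Transfer along a similarity\<close>

lemma similar_lattices_refl: "similar_lattices L L"
  unfolding similar_lattices_def
  by (intro exI[of _ 1] exI[of _ "mat 1"]) (auto simp: orthogonal_matrix_id)

theorem corollary1p5:
  fixes L V :: "(real^'n) set"
  assumes "CARD('n) \<ge> 2"
    and "similarity_class L \<in> WR_nearly_orthogonal_classes"
    and "V \<subseteq> min_vectors L" and "independent V" and "card V = CARD('n)"
  shows "lattice_basis L V"
proof -
  obtain L0 B0 where L0: "similarity_class L = similarity_class L0"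
    and B0: "lattice_basis L0 B0" "nearly_orthogonal B0"
    using assms(2) unfolding WR_nearly_orthogonal_classes_def by auto
  \<comment> \<open>By reflexivity \<open>L\<close> lies in its own class, which is that of
    \<open>L0\<close>.\<close>
  have "similar_lattices L0 L"
    using L0 similar_lattices_refl[of L] unfolding similarity_class_def by auto
  then obtain \<alpha> and U :: "real^'n^'n" where \<alpha>: "\<alpha> > 0" and U: "orthogonal_matrix U"
    and L: "L = (\<lambda>x. \<alpha> *\<^sub>R (U *v x)) ` L0"
    unfolding similar_lattices_def by blast
  \<comment> \<open>\<open>g\<close> maps \<open>L0\<close> onto \<open>L\<close> and multiplies
    inner products by \<open>\<alpha>^2\<close>, so the image of \<open>B0\<close> is a basis of
    \<open>L\<close> with the same angle bound.\<close>
  define g where "g = (\<lambda>x. \<alpha> *\<^sub>R (U *v x))"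
  have lin: "linear g" unfolding g_def by (intro linear_compose_scale_right) simp
  have orth: "orthogonal_transformation ((*v) U)"
    using U by (simp add: orthogonal_transformation_matrix)
  have inner_g: "g x \<bullet> g y = \<alpha>\<^sup>2 * (x \<bullet> y)" for x y
    using orth by (simp add: g_def orthogonal_transformation_def power2_eq_square)
  have norm_g: "norm (g x) = \<alpha> * norm x" for x
    using orth \<alpha> by (simp add: g_def orthogonal_transformation_norm)
  have inj: "inj g"
    unfolding linear_injective_0[OF lin] using norm_g \<alpha> by (metis mult_eq_0_iff norm_eq_zero
        less_irrefl)
  define B where "B = g ` B0"
  have indep0: "independent B0" and card0: "card B0 = CARD('n)" and L0B: "L0 = int_span B0"
    using B0(1) unfolding lattice_basis_iff by auto
  have LB: "L = int_span B" using int_span_image[OF lin inj, of B0] L L0B by (simp add: B_def g_def)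
  have indep: "independent B" unfolding B_def
    using linear_independent_injective_image[OF lin indep0] inj by (simp add: inj_on_subset)
  have card: "card B = CARD('n)" unfolding B_def
    using card0 card_image[of g B0] inj by (simp add: inj_on_subset)
  have span_UNIV: "span A = UNIV" if "independent A" "card A = CARD('n)" for A :: "(real^'n) set"
    using card_ge_dim_independent[of A UNIV] that by auto
  have finB0: "finite B0" and finV: "finite V"
    using indep0 assms(4) independent_imp_finite by auto
  have min: "v \<in> int_span B" "norm v = min_norm L" if "v \<in> V" for v
    using that assms(3) LB unfolding min_vectors_def by auto
  \<comment> \<open>The infimum \<open>min_norm L\<close> is the norm of the nonzero vector
    \<open>v0\<close>, hence positive.\<close>
  obtain v0 where v0: "v0 \<in> V" using assms(5) by fastforce
  have pos: "min_norm L > 0"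
    using min(2)[OF v0] v0 assms(4) dependent_zero[of V] by (metis zero_less_norm_iff)
  interpret short_angle_basis B "min_norm L"
  proof
    show "finite B" using finB0 by (simp add: B_def)
    show "independent B" by fact
    show "span B = UNIV" using span_UNIV indep card by blast
    show "min_norm L > 0" by fact
    show "min_norm L \<le> norm x" if "x \<in> int_span B" "x \<noteq> 0" for x
      unfolding min_norm_def using that LB
      by (intro cInf_lower bdd_belowI2[of _ 0]) auto
    show "\<bar>b \<bullet> w\<bar> \<le> norm b * norm w / 2" if b: "b \<in> B" and w: "w \<in> span (B - {b})" for b w
    proof -
      obtain b0 where b0: "b0 \<in> B0" "b = g b0" using b unfolding B_def by auto
      have "B - {b} = g ` (B0 - {b0})"
        unfolding B_def b0(2) using inj by (auto dest: injD)
      then obtain w0 where w0: "w0 \<in> span (B0 - {b0})" "w = g w0"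
        using w linear_span_image[OF lin, of "B0 - {b0}"] by auto
      have "\<alpha>\<^sup>2 * \<bar>b0 \<bullet> w0\<bar> \<le> \<alpha>\<^sup>2 * (norm b0 * norm w0 / 2)"
        by (intro mult_left_mono nearly_orthogonal_abs_inner_le[OF B0(2) finB0] b0 w0) simp
      then show ?thesis
        unfolding b0(2) w0(2) inner_g norm_g by (simp add: abs_mult power2_eq_square mult_ac)
    qed
  qed
  have "B \<subseteq> int_span V"
    by (rule basis_subset_int_span[OF finV span_UNIV[OF assms(4,5)]]) (use min in auto)
  moreover have "V \<subseteq> int_span B" using min(1) by blast
  ultimately have "L = int_span V" using int_span_subset LB by blast
  then show ?thesis using assms(4,5) unfolding lattice_basis_iff by blast
qed

end
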